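(* Let $C_1,\dots,C_m$ be closed convex subsets of a Euclidean space $X$, $I=\{1,\dots,m\}$, and suppose that $\bigcap_{i\in I_p}C_i\cap\bigcap_{i\in I\setminus I_p}\mathrm{ri}\,C_i\ne\varnothing$, where $I_p:=\{i\in I: C_i\text{ is polyhedral}\}$. Let $\lambda_i\in(0,2]$ for every $i\in I$ and suppose that there is at most one $\lambda_i$ equal to $2$, with the corresponding $C_i$ being a translation of an obtuse cone in $X$. Then, regardless of the starting point, every cyclic relaxed projection sequence generated by $(P_{C_i}^{\lambda_i})_{i\in I}$ converges $R$-linearly to a point $\bar x\in C:=\bigcap_{i\in I}C_i$. In particular, set $J:=\{i\in I:\lambda_i=2\}$, assume $m\ge2$ if $J\ne\varnothing$, and set $\nu:=\min\big(\{1\}\cup\{\lambda_i:i\in I\setminus J\}\big)$. For every starting point $x_0\in X$, the linear rate is $$\rho:=\left[1-\frac{\nu^2}{\kappa^2}\Big(\sum_{i\in I\setminus J}\frac{\lambda_i}{2-\lambda_i}\Big)^{-1}\right]_+^{\frac{1}{2m}},$$ where $\kappa>0$ is a linear regularity modulus of $\{C_i\}_{i\in I}$ on $\mathbb{B}(w;\delta/2)$ for some $\delta>0$ satisfying $\delta\ge2d_C(x_0)$ and some $w\in C$ satisfying $\delta\ge 2\|x_0-w\|$.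
   Context: $X$ is a Euclidean space with inner product $\langle\cdot,\cdot\rangle$ and norm $\|\cdot\|$. $\mathbb{B}(w;\rho)$ is the closed ball with center $w$ and radius $\rho$. $\mathrm{ri}$ denotes relative interior. $[t]_+:=\max\{0,t\}$. For a nonempty closed set $C$: $d_C(x)=\inf_{c\in C}\|x-c\|$, $P_Cx=\{c\in C:\|x-c\|=d_C(x)\}$ (a singleton for convex $C$), and the relaxed projector with parameter $\lambda\ge0$ is $P_C^\lambda:=(1-\lambda)\mathrm{Id}+\lambda P_C$. A closed convex cone $K$ of $X$ is obtuse if $-K^\ominus\subseteq K$, where $K^\ominus:=\{y\in X: \langle x,y\rangle\le0\ \text{for all }x\in K\}$. A translation of $K$ is a set $c+K$ with $c\in X$. Cyclic sequences: for operators $T_1,\dots,T_m$ on $X$, put $T_{mn+i}:=T_i$ for $n\in\mathbb{N}$, $i\in I$; a cyclic sequence generated by $(T_i)_{i\in I}$ is any sequence with $x_0\in X$ and $x_{n+1}\in T_{n+1}x_n$ (that is, $x_{n+1}=T_{n+1}x_n$ for single-valued operators) for all $n\in\mathbb{N}=\{0,1,2,\dots\}$. $R$-linear convergence: $(x_n)$ converges $R$-linearly to $\bar x$ with rate $\rho\in[0,1)$ if there is $\sigma\ge0$ with $\|x_n-\bar x\|\le\sigma\rho^n$ for all $n\in\mathbb{N}$; it converges $R$-linearly if this holds for some rate $\rho\in[0,1)$. Linear regularity: $\kappa>0$ is a linear regularity modulus of $\{C_i\}_{i\in I}$ on $U\subseteq X$ if $d_C(x)\le\kappa\max_{i\in I}d_{C_i}(x)$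 for all $x\in U$, where $C=\bigcap_{i\in I}C_i$.
   Formalization: When ρ=0 and J≠∅ the rate claim can fail (X=ℝ, C₁=[0,∞), λ₁=2, C₂=[1,∞), λ₂=1, x₀=-1/4, w=1, δ=5/2, κ=1: x₁=1/4, limit 1); in that case only x_n=x̄ for all n≥2m is asserted. *)

theory Defs
  imports "HOL-Analysis.Analysis"
begin

definition polar_cone :: "'a::euclidean_space set \<Rightarrow> 'a set" where
  "polar_cone K = {y. \<forall>x\<in>K. x \<bullet> y \<le> 0}"

text \<open>The empty set satisfies the library predicate \<^const>\<open>cone\<close>, but it is excluded below: its
  polar cone is the whole space.\<close>

definition obtuse_cone :: "'a::euclidean_space set \<Rightarrow> bool" where
  "obtuse_cone K \<longleftrightarrow> closed K \<and> convex K \<and> cone K \<and> uminus ` polar_cone K \<subseteq> K"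

definition is_translation_of :: "'a::euclidean_space set \<Rightarrow> 'a set \<Rightarrow> bool" where
  "is_translation_of S K \<longleftrightarrow> (\<exists>c. S = (+) c ` K)"

text \<open>For nonempty closed convex \<open>S\<close> the nearest point is unique, so \<^const>\<open>closest_point\<close> is
  the metric projection onto \<open>S\<close>, and \<^const>\<open>infdist\<close> is the distance function.\<close>

definition relaxed_proj :: "real \<Rightarrow> 'a::euclidean_space set \<Rightarrow> 'a \<Rightarrow> 'a" where
  "relaxed_proj l S x = (1 - l) *\<^sub>R x + l *\<^sub>R closest_point S x"

text \<open>The operators \<open>T 1, \<dots>, T m\<close> are extended by \<open>T (m * n + i) = T i\<close>, so the one producing
  the iterate \<open>x (n + 1)\<close> has index \<open>n mod m + 1\<close>.\<close>

definition cyclic_sequence :: "nat \<Rightarrow> (nat \<Rightarrow> 'a \<Rightarrow> 'a) \<Rightarrow> (nat \<Rightarrow> 'a) \<Rightarrow> bool" where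
  "cyclic_sequence m T x \<longleftrightarrow> (\<forall>n. x (Suc n) = T (n mod m + 1) (x n))"

text \<open>The bound is required for every \<open>n\<close> and \<open>0 ^ 0 = 1\<close>, so rate \<open>0\<close> means that
  \<open>x n = l\<close> for all \<open>n \<ge> 1\<close>.  A relaxed projection sequence containing a reflection may reach
  its limit after finitely many, but more than one, steps; \<open>cyclic_rate\<close> below can then be \<open>0\<close>
  although \<open>0\<close> is not a rate in this sense.\<close>

definition R_linear_rate :: "(nat \<Rightarrow> 'a::euclidean_space) \<Rightarrow> 'a \<Rightarrow> real \<Rightarrow> bool" where
  "R_linear_rate x l r \<longleftrightarrow> 0 \<le> r \<and> r < 1 \<and> (\<exists>\<sigma>\<ge>0. \<forall>n. norm (x n - l) \<le> \<sigma> * r ^ n)"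

definition R_linear_convergent_to :: "(nat \<Rightarrow> 'a::euclidean_space) \<Rightarrow> 'a \<Rightarrow> bool" where
  "R_linear_convergent_to x l \<longleftrightarrow> (\<exists>r. R_linear_rate x l r)"

definition linear_regularity_modulus ::
    "real \<Rightarrow> 'i set \<Rightarrow> ('i \<Rightarrow> 'a::euclidean_space set) \<Rightarrow> 'a set \<Rightarrow> bool" where
  "linear_regularity_modulus \<kappa> I C U \<longleftrightarrow>
     \<kappa> > 0 \<and> (\<forall>x\<in>U. infdist x (\<Inter>i\<in>I. C i) \<le> \<kappa> * (MAX i\<in>I. infdist x (C i)))"

definition admissible_modulus ::
    "nat \<Rightarrow> (nat \<Rightarrow> 'a::euclidean_space set) \<Rightarrow> 'a \<Rightarrow> real \<Rightarrow> bool" where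
  "admissible_modulus m C x0 \<kappa> \<longleftrightarrow>
     (\<exists>\<delta>>0. \<exists>w\<in>(\<Inter>i\<in>{1..m}. C i).
        \<delta> \<ge> 2 * infdist x0 (\<Inter>i\<in>{1..m}. C i) \<and> \<delta> \<ge> 2 * norm (x0 - w) \<and>
        linear_regularity_modulus \<kappa> {1..m} C (cball w (\<delta> / 2)))"

definition reflection_indices :: "nat \<Rightarrow> (nat \<Rightarrow> real) \<Rightarrow> nat set" where
  "reflection_indices m lam = {i \<in> {1..m}. lam i = 2}"

definition cyclic_rate :: "nat \<Rightarrow> (nat \<Rightarrow> real) \<Rightarrow> real \<Rightarrow> real" where
  "cyclic_rate m lam \<kappa> =
     (let N = {1..m} - reflection_indices m lam;
          \<nu> = Min ({1} \<union> lam ` N)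
      in max 0 (1 - \<nu>\<^sup>2 / \<kappa>\<^sup>2 * inverse (\<Sum>i\<in>N. lam i / (2 - lam i))) powr (1 / (2 * real m)))"

end

theory Submission
  imports Defs
begin

text \<open>Each step is Fejer monotone with respect to \<open>C\<close>, and a step with \<open>\<lambda>\<^sub>i < 2\<close> decreases the
  squared distance to \<open>C\<close> by a multiple of its squared length.  The distances \<open>d\<^bsub>C i\<^esub>\<close> at the start of
  a cycle are bounded by the total length of its steps, so Cauchy-Schwarz and linear regularity give
  a geometric decrease of \<open>d\<^bsub>C\<^esub>\<close> over a cycle, and Fejer monotonicity turns it into \<open>R\<close>-linear
  convergence.  A reflection lands in the set it reflects in, so cycles that start after the
  reflection need no decrease from it.  Linear regularity on balls comes from Hoffman's error bound
  for polyhedra.\<close>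

section \<open>Bounded linear regularity\<close>

text \<open>The sum in the rate comes from weighting Cauchy-Schwarz. A relaxed step at distance
  \<open>d\<close> from its set has length \<open>lam * d\<close> and gains
  \<open>lam * (2 - lam) * d ^ 2\<close>, that is \<open>(2 - lam) / lam\<close> times its squared
  length; the reciprocal weights \<open>lam / (2 - lam)\<close> then add up over the cycle. At
  \<open>lam = 2\<close> the gain is zero and the weight infinite, which is the obstacle: a
  reflection has to stay outside the window of estimated steps, and a second one could not be kept
  out as well. The minimum with \<open>1\<close> in \<open>\<nu>\<close> arises because the distance
  to one set is seen through a step of length \<open>lam i\<close> times it, while the path leading
  to that step is counted with factor \<open>1\<close>. Starting the windows after the reflection
  leaves an initial stretch without any estimate. A positive rate absorbs it in the constant, a zero
  rate cannot; hence the separate treatment of rate \<open>0\<close>.\<close>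

lemma infdist_eq_closest_point:
  fixes S :: "'a::euclidean_space set"
  assumes "closed S" "S \<noteq> {}"
  shows "infdist x S = dist x (closest_point S x)"
proof (rule antisym)
  show "infdist x S \<le> dist x (closest_point S x)"
    by (intro infdist_le closest_point_in_set assms)
  show "dist x (closest_point S x) \<le> infdist x S"
    unfolding infdist_notempty[OF assms(2)]
    by (rule cINF_greatest) (use assms closest_point_le in auto)
qed

text \<open>If the sum vanished at a unit vector \<open>u\<close> of the polar set, \<open>u\<close>
  could serve as \<open>y\<close> in its own polarity condition, giving
  \<open>u \<bullet> u \<le> 0\<close>. So the sum has a positive minimum over the unit vectors of
  that set, and positive homogeneity carries the bound to every length.\<close>

lemma norm_le_sum_pos_part_on_polar:
  fixes a :: "'i \<Rightarrow> 'a::euclidean_space"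
  assumes "finite A"
  shows "\<exists>c\<ge>0. \<forall>u. (\<forall>y. (\<forall>j\<in>A. a j \<bullet> y \<le> 0) \<longrightarrow> u \<bullet> y \<le> 0)
           \<longrightarrow> norm u \<le> c * (\<Sum>j\<in>A. max 0 (a j \<bullet> u))"
proof -
  define polar where "polar u \<longleftrightarrow> (\<forall>y. (\<forall>j\<in>A. a j \<bullet> y \<le> 0) \<longrightarrow> u \<bullet> y \<le> 0)" for u
  define f where "f u = (\<Sum>j\<in>A. max 0 (a j \<bullet> u))" for u
  define S where "S = {u. polar u} \<inter> sphere 0 1"
  have "{u. polar u} = (\<Inter>y\<in>{y. \<forall>j\<in>A. a j \<bullet> y \<le> 0}. {u. y \<bullet> u \<le> 0})"
    by (auto simp: polar_def inner_commute)
  then have "closed {u. polar u}"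
    by (simp add: closed_INT closed_halfspace_le)
  then have "compact S"
    unfolding S_def by (intro closed_Int_compact compact_sphere)
  have f_pos: "f u > 0" if "u \<in> S" for u
  proof (rule ccontr)
    assume "\<not> f u > 0"
    moreover have "f u \<ge> 0" unfolding f_def by (simp add: sum_nonneg)
    ultimately have "f u = 0" by simp
    then have "\<forall>j\<in>A. max 0 (a j \<bullet> u) = 0"
      unfolding f_def using assms by (subst (asm) sum_nonneg_eq_0_iff) auto
    then have "\<forall>j\<in>A. a j \<bullet> u \<le> 0" by (metis max.cobounded2)
    with that have "u \<bullet> u \<le> 0" by (auto simp: S_def polar_def)
    with that show False by (auto simp: S_def dot_square_norm)
  qed
  obtain c where c: "c > 0" "\<And>u. u \<in> S \<Longrightarrow> c \<le> f u"
  proof (cases "S = {}")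
    \<comment> \<open>The polar set may be \<open>{0}\<close>; then there is no minimum to take and
      any positive constant serves.\<close>
    case True
    then show ?thesis using that[of 1] by simp
  next
    case False
    have "continuous_on S f"
      unfolding f_def by (intro continuous_intros)
    from continuous_attains_inf[OF \<open>compact S\<close> False this] obtain v
      where "v \<in> S" "\<forall>u\<in>S. f v \<le> f u" by auto
    then show ?thesis using that f_pos by blast
  qed
  have "norm u \<le> inverse c * f u" if "polar u" for u
  proof (cases "u = 0")
    case False
    have "polar (u /\<^sub>R norm u)"
      using that by (auto simp: polar_def mult_nonneg_nonpos)
    then have "c \<le> f (u /\<^sub>R norm u)"
      using False by (intro c(2)) (simp add: S_def)
    also have "f (u /\<^sub>R norm u) = f u / norm u"
      unfolding f_def sum_divide_distrib
      using max_mult_distrib_left[of "inverse (norm u)" 0]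
      by (intro sum.cong) (auto simp: divide_inverse mult.commute)
    finally show ?thesis using False c(1) by (simp add: field_simps)
  qed (simp add: f_def)
  with c(1) show ?thesis
    unfolding polar_def f_def by (intro exI[of _ "inverse c"]) auto
qed

text \<open>Only the constraints active at the projection of \<open>x\<close> matter, and there are finitely many
  possible active sets; a Lipschitz constant for each comes from compactness of the unit sphere.\<close>

lemma hoffman_halfspaces:
  fixes a :: "'i \<Rightarrow> 'a::euclidean_space" and b :: "'i \<Rightarrow> real"
  assumes "finite J" and ne: "{x. \<forall>j\<in>J. a j \<bullet> x \<le> b j} \<noteq> {}"
  shows "\<exists>\<kappa>\<ge>0. \<forall>x. infdist x {x. \<forall>j\<in>J. a j \<bullet> x \<le> b j} \<le> \<kappa> * (\<Sum>j\<in>J. max 0 (a j \<bullet> x - b j))"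
proof -
  define P where "P = {x. \<forall>j\<in>J. a j \<bullet> x \<le> b j}"
  have P_eq: "P = (\<Inter>j\<in>J. {x. a j \<bullet> x \<le> b j})" by (auto simp: P_def)
  have P: "closed P" "convex P" "P \<noteq> {}"
    unfolding P_eq using ne
    by (auto intro!: closed_INT convex_INT simp: closed_halfspace_le convex_halfspace_le)
  have "\<forall>A\<in>Pow J. \<exists>c\<ge>0. \<forall>u. (\<forall>y. (\<forall>j\<in>A. a j \<bullet> y \<le> 0) \<longrightarrow> u \<bullet> y \<le> 0)
           \<longrightarrow> norm u \<le> c * (\<Sum>j\<in>A. max 0 (a j \<bullet> u))"
    using assms(1) by (intro ballI norm_le_sum_pos_part_on_polar) (auto intro: finite_subset)
  then obtain c where c0: "\<And>A. A \<in> Pow J \<Longrightarrow> c A \<ge> 0"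
    and c: "\<And>A u. A \<in> Pow J \<Longrightarrow> (\<And>y. (\<forall>j\<in>A. a j \<bullet> y \<le> 0) \<Longrightarrow> u \<bullet> y \<le> 0)
           \<Longrightarrow> norm u \<le> c A * (\<Sum>j\<in>A. max 0 (a j \<bullet> u))"
    by metis
  \<comment> \<open>Summing over all subsets gives one constant for every possible active set, hence
    one independent of \<open>x\<close>.\<close>
  define \<kappa> where "\<kappa> = (\<Sum>A\<in>Pow J. c A)"
  have "infdist x P \<le> \<kappa> * (\<Sum>j\<in>J. max 0 (a j \<bullet> x - b j))" for x
  proof -
    define p where "p = closest_point P x"
    define A where "A = {j\<in>J. a j \<bullet> p = b j}"
    have pP: "p \<in> P" unfolding p_def using P by (intro closest_point_in_set)
    \<comment> \<open>A short move from \<open>p\<close> along \<open>y\<close> stays in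
      \<open>P\<close>: active constraints do not increase, and inactive ones are strict at
      \<open>p\<close>. The variational inequality of the projection then gives the sign.\<close>
    have "(x - p) \<bullet> y \<le> 0" if y: "\<forall>j\<in>A. a j \<bullet> y \<le> 0" for y
    proof -
      have "\<forall>j\<in>J. \<forall>\<^sub>F t in at_right 0. a j \<bullet> (p + t *\<^sub>R y) \<le> b j"
      proof
        fix j assume j: "j \<in> J"
        show "\<forall>\<^sub>F t in at_right 0. a j \<bullet> (p + t *\<^sub>R y) \<le> b j"
        proof (cases "j \<in> A")
          case True
          then show ?thesis
            using y by (intro eventually_at_rightI[of 0 1])
              (auto simp: A_def inner_right_distrib mult_nonneg_nonpos)
        next
          case False
          with j pP have "a j \<bullet> p < b j" by (force simp: A_def P_def)
          moreover have "((\<lambda>t. a j \<bullet> (p + t *\<^sub>R y)) \<longlongrightarrow> a j \<bullet> (p + 0 *\<^sub>R y)) (at_right 0)"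
            by (intro tendsto_intros)
          ultimately have "\<forall>\<^sub>F t in at_right 0. a j \<bullet> (p + t *\<^sub>R y) < b j"
            by (intro order_tendstoD) auto
          then show ?thesis by (rule eventually_mono) simp
        qed
      qed
      then have "\<forall>\<^sub>F t in at_right 0. \<forall>j\<in>J. a j \<bullet> (p + t *\<^sub>R y) \<le> b j"
        using assms(1) by (simp add: eventually_ball_finite)
      then have "\<forall>\<^sub>F t in at_right 0. p + t *\<^sub>R y \<in> P \<and> t > 0"
        using eventually_at_right_less[of 0] by eventually_elim (auto simp: P_def)
      then obtain t where t: "p + t *\<^sub>R y \<in> P" "t > (0::real)"
        using eventually_happens'[OF trivial_limit_at_right_real] by blast
      from closest_point_dot[OF P(2,1) t(1), of x] show ?thesis
        using t(2) by (simp add: p_def[symmetric] mult_le_0_iff)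
    qed
    then have "norm (x - p) \<le> c A * (\<Sum>j\<in>A. max 0 (a j \<bullet> (x - p)))"
      by (intro c) (auto simp: A_def)
    also have "\<dots> = c A * (\<Sum>j\<in>A. max 0 (a j \<bullet> x - b j))"
      by (intro arg_cong[where f = "\<lambda>s. _ * s"] sum.cong) (auto simp: A_def inner_diff_right)
    also have "\<dots> \<le> \<kappa> * (\<Sum>j\<in>J. max 0 (a j \<bullet> x - b j))"
    proof (rule mult_mono)
      show "c A \<le> \<kappa>"
        unfolding \<kappa>_def using assms(1) c0 by (intro member_le_sum) (auto simp: A_def)
      show "(\<Sum>j\<in>A. max 0 (a j \<bullet> x - b j)) \<le> (\<Sum>j\<in>J. max 0 (a j \<bullet> x - b j))"
        using assms(1) by (intro sum_mono2) (auto simp: A_def)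
    qed (auto simp: \<kappa>_def intro!: sum_nonneg c0)
    finally show ?thesis
      using P by (simp add: infdist_eq_closest_point p_def dist_norm)
  qed
  moreover have "\<kappa> \<ge> 0" unfolding \<kappa>_def by (intro sum_nonneg c0)
  ultimately show ?thesis unfolding P_def by blast
qed

text \<open>The projection of \<open>x\<close> onto \<open>P\<close> lies in every halfspace
  \<open>h\<close> defining \<open>P\<close>, so the residual of \<open>h\<close> at
  \<open>x\<close> is at most \<open>norm (a h)\<close> times the distance to \<open>P\<close>.
  Using an upper bound \<open>e\<close> instead of a maximum keeps the statement meaningful for an
  empty family.\<close>

lemma hoffman_polyhedra:
  fixes \<P> :: "'a::euclidean_space set set"
  assumes "finite \<P>" "\<And>P. P \<in> \<P> \<Longrightarrow> polyhedron P" "\<Inter>\<P> \<noteq> {}"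
  shows "\<exists>\<kappa>\<ge>0. \<forall>x e. 0 \<le> e \<longrightarrow> (\<forall>P\<in>\<P>. infdist x P \<le> e) \<longrightarrow> infdist x (\<Inter>\<P>) \<le> \<kappa> * e"
proof -
  have "\<forall>P\<in>\<P>. \<exists>F. finite F \<and> P = \<Inter>F \<and> (\<forall>h\<in>F. \<exists>a b. a \<noteq> 0 \<and> h = {x. a \<bullet> x \<le> b})"
    using assms(2) unfolding polyhedron_def by blast
  then obtain F where F: "\<And>P. P \<in> \<P> \<Longrightarrow> finite (F P)" "\<And>P. P \<in> \<P> \<Longrightarrow> P = \<Inter>(F P)"
    "\<And>P h. P \<in> \<P> \<Longrightarrow> h \<in> F P \<Longrightarrow> \<exists>a b. a \<noteq> 0 \<and> h = {x. a \<bullet> x \<le> b}"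
    by metis
  define H where "H = (\<Union>P\<in>\<P>. F P)"
  have "\<forall>h\<in>H. \<exists>a b. h = {x. a \<bullet> x \<le> b}" using F(3) by (auto simp: H_def) blast
  then obtain a b where ab: "\<And>h. h \<in> H \<Longrightarrow> h = {x. a h \<bullet> x \<le> b h}" by metis
  have finH: "finite H" unfolding H_def using assms(1) F(1) by auto
  have "\<Inter>\<P> = \<Inter>H"
    using F(2) unfolding H_def by blast
  also have "\<dots> = {x. \<forall>h\<in>H. a h \<bullet> x \<le> b h}" using ab by blast
  finally have eq: "\<Inter>\<P> = {x. \<forall>h\<in>H. a h \<bullet> x \<le> b h}" .
  obtain \<kappa> where \<kappa>: "\<kappa> \<ge> 0"
    "\<And>x. infdist x (\<Inter>\<P>) \<le> \<kappa> * (\<Sum>h\<in>H. max 0 (a h \<bullet> x - b h))"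
    using hoffman_halfspaces[OF finH, of a b] assms(3) unfolding eq by blast
  have "infdist x (\<Inter>\<P>) \<le> (\<kappa> * (\<Sum>h\<in>H. norm (a h))) * e"
    if e: "0 \<le> e" "\<forall>P\<in>\<P>. infdist x P \<le> e" for x e
  proof -
    have "max 0 (a h \<bullet> x - b h) \<le> norm (a h) * e" if "h \<in> H" for h
    proof -
      obtain P where P: "P \<in> \<P>" "h \<in> F P" using \<open>h \<in> H\<close> by (auto simp: H_def)
      define p where "p = closest_point P x"
      have "P \<noteq> {}" "closed P" using P assms by (auto intro: polyhedron_imp_closed)
      then have "p \<in> P" "infdist x P = norm (x - p)"
        unfolding p_def by (simp_all add: closest_point_in_set infdist_eq_closest_point dist_norm)
      then have "norm (x - p) \<le> e" using e(2) P(1) by fastforce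
      have "p \<in> h" using \<open>p \<in> P\<close> F(2) P by blast
      then have "a h \<bullet> p \<le> b h" using ab that by blast
      then have "a h \<bullet> x - b h \<le> a h \<bullet> (x - p)" by (simp add: inner_diff_right)
      also have "\<dots> \<le> norm (a h) * norm (x - p)" by (rule norm_cauchy_schwarz)
      also have "\<dots> \<le> norm (a h) * e" using \<open>norm (x - p) \<le> e\<close> by (simp add: mult_left_mono)
      finally show ?thesis using e(1) by simp
    qed
    then have "(\<Sum>h\<in>H. max 0 (a h \<bullet> x - b h)) \<le> (\<Sum>h\<in>H. norm (a h)) * e"
      unfolding sum_distrib_right by (rule sum_mono)
    then show ?thesis
      using \<kappa> order_trans[OF \<kappa>(2)[of x] mult_left_mono] by (simp add: mult.assoc)
  qed
  moreover have "\<kappa> * (\<Sum>h\<in>H. norm (a h)) \<ge> 0" using \<kappa>(1) by (simp add: sum_nonneg)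
  ultimately show ?thesis by blast
qed

text \<open>Replace each \<open>C i\<close> with \<open>i \<notin> A\<close> by its affine hull, so that Hoffman's bound applies, and then
  move the resulting point towards \<open>z\<close>, whose relative neighbourhoods in these \<open>C i\<close> absorb the
  remaining error.\<close>

lemma bounded_linear_regularity:
  fixes C :: "'i \<Rightarrow> 'a::euclidean_space set"
  assumes "finite I" "A \<subseteq> I"
    and cc: "\<And>i. i \<in> I \<Longrightarrow> closed (C i) \<and> convex (C i)"
    and poly: "\<And>i. i \<in> A \<Longrightarrow> polyhedron (C i)"
    and zA: "\<And>i. i \<in> A \<Longrightarrow> z \<in> C i"
    and zri: "\<And>i. i \<in> I - A \<Longrightarrow> z \<in> rel_interior (C i)"
  shows "\<exists>\<kappa>>0. \<forall>x\<in>cball w R. \<forall>e\<ge>0. (\<forall>i\<in>I. infdist x (C i) \<le> e)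
           \<longrightarrow> infdist x (\<Inter>i\<in>I. C i) \<le> \<kappa> * e"
proof -
  have zC: "z \<in> C i" if "i \<in> I" for i
    using that zA zri rel_interior_subset by blast
  define \<P> where "\<P> = C ` A \<union> (\<lambda>i. affine hull C i) ` (I - A)"
  have \<P>: "finite \<P>" "\<And>P. P \<in> \<P> \<Longrightarrow> polyhedron P" "z \<in> \<Inter>\<P>"
    unfolding \<P>_def using assms(1,2) poly zC
    by (auto intro: affine_imp_polyhedron hull_inc dest: finite_subset)
  then have clP: "closed (\<Inter>\<P>)" "convex (\<Inter>\<P>)" "\<Inter>\<P> \<noteq> {}"
    by (auto intro!: closed_Inter convex_Inter polyhedron_imp_closed polyhedron_imp_convex)
  obtain h where h: "h \<ge> 0"
    "\<And>x e. 0 \<le> e \<Longrightarrow> (\<forall>P\<in>\<P>. infdist x P \<le> e) \<Longrightarrow> infdist x (\<Inter>\<P>) \<le> h * e"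
    using hoffman_polyhedra[OF \<P>(1,2) clP(3)] by blast
  have "\<forall>i\<in>I - A. \<exists>r>0. cball z r \<inter> affine hull C i \<subseteq> C i"
    using zri unfolding mem_rel_interior_cball by blast
  then obtain r' where r': "\<And>i. i \<in> I - A \<Longrightarrow> r' i > 0"
    "\<And>i. i \<in> I - A \<Longrightarrow> cball z (r' i) \<inter> affine hull C i \<subseteq> C i"
    by metis
  \<comment> \<open>One radius for all indices outside \<open>A\<close>; the inserted
    \<open>1\<close> keeps \<open>Min\<close> meaningful when there are none.\<close>
  define r where "r = Min (insert 1 (r' ` (I - A)))"
  have r0: "r > 0" unfolding r_def using assms(1) r'(1) by (subst Min_gr_iff) auto
  have r: "y \<in> C i" if "i \<in> I - A" "dist z y \<le> r" "y \<in> affine hull C i" for i y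
  proof -
    have "r \<le> r' i" unfolding r_def using assms(1) that(1) by (intro Min_le) auto
    then show ?thesis using r'(2)[OF that(1)] that by (auto simp: subset_iff)
  qed
  define M where "M = \<bar>R\<bar> + dist w z"
  define \<kappa> where "\<kappa> = h + (1 + h) / r * M + 1"
  have "infdist x (\<Inter>i\<in>I. C i) \<le> \<kappa> * e"
    if x: "x \<in> cball w R" and e: "e \<ge> 0" "\<forall>i\<in>I. infdist x (C i) \<le> e" for x e
  proof -
    define q where "q = closest_point (\<Inter>\<P>) x"
    \<comment> \<open>\<open>d\<close> bounds the distance from \<open>q\<close> to each
      \<open>C i\<close>: at most \<open>h * e\<close> back to \<open>x\<close>, and
      \<open>e\<close> from there. For \<open>d\<close> nonzero, \<open>t\<close> solves
      \<open>t * (r / d) = 1 - t\<close>, so that a displacement of length at most \<open>r\<close>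
      at \<open>z\<close> compensates the error \<open>q - p\<close> in the convex combination
      \<open>y\<close>.\<close>
    define d where "d = (1 + h) * e"
    define t where "t = d / (d + r)"
    define y where "y = (1 - t) *\<^sub>R q + t *\<^sub>R z"
    have d0: "d \<ge> 0" using h(1) e(1) by (simp add: d_def)
    have t: "0 \<le> t" "t \<le> 1" "t \<le> d / r" "1 - t = r / (d + r)"
      using d0 r0 by (auto simp: t_def field_simps)
    have qP: "q \<in> \<Inter>\<P>" unfolding q_def using clP by (intro closest_point_in_set)
    have "infdist x P \<le> e" if "P \<in> \<P>" for P
    proof -
      have "infdist x (affine hull C i) \<le> e" if "i \<in> I" for i
        using zC[OF that] e(2) that
        by (intro order_trans[OF infdist_mono[OF hull_subset]]) auto
      with that e(2) assms(2) show ?thesis unfolding \<P>_def by blast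
    qed
    with h(2)[OF e(1), of x] have xq: "dist x q \<le> h * e"
      using clP by (simp add: q_def infdist_eq_closest_point)
    have "y \<in> C i" if i: "i \<in> I" for i
    proof (cases "i \<in> A")
      case True
      then have "q \<in> C i" using qP by (auto simp: \<P>_def)
      then show ?thesis
        unfolding y_def using zC[OF i] cc[OF i] t by (intro convexD) auto
    next
      case False
      define p where "p = closest_point (C i) q"
      have Ci: "closed (C i)" "convex (C i)" "C i \<noteq> {}" using cc[OF i] zC[OF i] by auto
      have pC: "p \<in> C i" unfolding p_def using Ci by (intro closest_point_in_set)
      have "dist q p = infdist q (C i)" using Ci by (simp add: p_def infdist_eq_closest_point)
      also have "\<dots> \<le> infdist x (C i) + dist q x" by (rule infdist_triangle)
      also have "\<dots> \<le> d" using bspec[OF e(2) i] xq by (simp add: d_def dist_commute distrib_right)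
      finally have qp: "dist q p \<le> d" .
      \<comment> \<open>The auxiliary point \<open>v\<close> needs \<open>d\<close> nonzero; for
        \<open>d = 0\<close> the points \<open>y\<close>, \<open>q\<close> and \<open>p\<close>
        coincide.\<close>
      show ?thesis
      proof (cases "d = 0")
        case True
        then have "y = p" using qp by (simp add: y_def t_def)
        then show ?thesis using pC by simp
      next
        case False
        define v where "v = z + (r / d) *\<^sub>R (q - p)"
        have "q \<in> affine hull C i" using qP i \<open>i \<notin> A\<close> by (auto simp: \<P>_def)
        then have v: "v \<in> affine hull C i"
          unfolding v_def using pC zC[OF i]
          by (intro mem_affine_3_minus) (auto intro: hull_inc)
        have "dist z v = r / d * dist q p"
          using r0 d0 by (simp add: v_def dist_norm)
        also have "\<dots> \<le> r / d * d"
          using qp r0 d0 by (intro mult_left_mono) auto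
        finally have "v \<in> C i"
          using i \<open>i \<notin> A\<close> False v by (intro r) auto
        moreover have "t * (r / d) = 1 - t" using t(4) False by (simp add: t_def)
        then have "y = (1 - t) *\<^sub>R p + t *\<^sub>R v"
          by (simp add: y_def v_def algebra_simps flip: scaleR_add_left)
        ultimately show ?thesis using pC Ci t by (auto intro: convexD)
      qed
    qed
    then have "infdist x (\<Inter>i\<in>I. C i) \<le> dist x y" by (intro infdist_le) auto
    also have "\<dots> \<le> dist x q + dist q y" by (rule dist_triangle)
    also have "dist q y = t * dist q z"
      using t(1) by (simp add: y_def dist_norm algebra_simps flip: scaleR_diff_right)
    also have "\<dots> \<le> d / r * M"
    proof (rule mult_mono)
      have "dist q z = dist q (closest_point (\<Inter>\<P>) z)"
        using \<P>(3) by (simp add: closest_point_self)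
      also have "\<dots> \<le> dist x z" unfolding q_def by (rule closest_point_lipschitz) (use clP in auto)
      also have "\<dots> \<le> dist w x + dist w z" by (metis dist_commute dist_triangle)
      also have "\<dots> \<le> M" using x by (simp add: M_def)
      finally show "dist q z \<le> M" .
    qed (use t d0 r0 in auto)
    also have "dist x q + d / r * M \<le> h * e + d / r * M" using xq by simp
    also have "\<dots> = (h + (1 + h) / r * M) * e" by (simp add: d_def algebra_simps)
    also have "\<dots> \<le> \<kappa> * e" unfolding \<kappa>_def using e(1) by (intro mult_right_mono) auto
    finally show ?thesis by simp
  qed
  moreover have "M \<ge> 0" by (simp add: M_def)
  then have "\<kappa> > 0" using h(1) r0 by (simp add: \<kappa>_def add_nonneg_pos)
  ultimately show ?thesis by blast
qed

section \<open>Relaxed projections and Fejer monotone sequences\<close>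

lemma relaxed_proj_norm_diff:
  fixes S :: "'a::euclidean_space set"
  assumes "closed S" "S \<noteq> {}" "0 \<le> l"
  shows "norm (relaxed_proj l S x - x) = l * infdist x S"
proof -
  have "relaxed_proj l S x - x = l *\<^sub>R (closest_point S x - x)"
    by (simp add: relaxed_proj_def algebra_simps)
  then show ?thesis
    using assms by (simp add: infdist_eq_closest_point dist_norm norm_minus_commute)
qed

text \<open>Expanding the square leaves the inner product of \<open>x - c\<close> and
  \<open>x - p\<close>, which is at least \<open>(norm (x - p))\<^sup>2\<close> because the angle at
  the projection \<open>p\<close> is not acute; then
  \<open>- 2 * l + l\<^sup>2 = - l * (2 - l)\<close>. For \<open>l = 2\<close> only nonexpansion
  remains.\<close>

lemma relaxed_proj_decrease:
  fixes S :: "'a::euclidean_space set"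
  assumes "closed S" "convex S" "c \<in> S" "0 \<le> l"
  shows "(norm (relaxed_proj l S x - c))\<^sup>2 \<le> (norm (x - c))\<^sup>2 - l * (2 - l) * (infdist x S)\<^sup>2"
proof -
  define p where "p = closest_point S x"
  have eq: "relaxed_proj l S x - c = (x - c) - l *\<^sub>R (x - p)"
    by (simp add: relaxed_proj_def p_def algebra_simps)
  have "(norm (u - l *\<^sub>R v))\<^sup>2 = (norm u)\<^sup>2 - 2 * l * (u \<bullet> v) + l\<^sup>2 * (norm v)\<^sup>2" for u v :: 'a
    unfolding power2_norm_eq_inner
    by (simp add: inner_diff inner_commute power2_eq_square algebra_simps)
  from this[of "x - c" "x - p"] have "(norm (relaxed_proj l S x - c))\<^sup>2
      = (norm (x - c))\<^sup>2 - 2 * l * ((x - c) \<bullet> (x - p)) + l\<^sup>2 * (norm (x - p))\<^sup>2"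
    by (simp only: eq)
  moreover have "(x - c) \<bullet> (x - p) = (norm (x - p))\<^sup>2 - (x - p) \<bullet> (c - p)"
    by (simp add: power2_norm_eq_inner inner_diff inner_commute algebra_simps)
  moreover have "(x - p) \<bullet> (c - p) \<le> 0"
    unfolding p_def using assms by (intro closest_point_dot)
  then have "l * ((x - p) \<bullet> (c - p)) \<le> 0" using assms(4) by (simp add: mult_nonneg_nonpos)
  moreover have "infdist x S = norm (x - p)"
    using assms by (subst infdist_eq_closest_point) (auto simp: p_def dist_norm)
  moreover have "X - 2 * l * (G - H) + l\<^sup>2 * G \<le> X - l * (2 - l) * G" if "l * H \<le> 0" for X G H
    using that by (simp add: power2_eq_square algebra_simps)
  ultimately show ?thesis by simp
qed

lemma relaxed_proj_fejer:
  fixes S :: "'a::euclidean_space set"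
  assumes "closed S" "convex S" "c \<in> S" "0 \<le> l" "l \<le> 2"
  shows "dist (relaxed_proj l S x) c \<le> dist x c"
proof -
  have "l * (2 - l) * (infdist x S)\<^sup>2 \<ge> 0" using assms by simp
  then have "(norm (relaxed_proj l S x - c))\<^sup>2 \<le> (norm (x - c))\<^sup>2"
    using relaxed_proj_decrease[OF assms(1-4), of x] by linarith
  then show ?thesis unfolding dist_norm by (rule power2_le_imp_le) simp
qed

text \<open>By Moreau's decomposition the reflection of \<open>x = p + u\<close> is \<open>p - u\<close> with \<open>p \<in> K\<close> and \<open>u\<close> in
  the polar cone.\<close>

lemma reflection_mem_obtuse:
  fixes S :: "'a::euclidean_space set"
  assumes "obtuse_cone K" "is_translation_of S K" "S \<noteq> {}"
  shows "relaxed_proj 2 S x \<in> S"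
proof -
  obtain c where S: "S = (+) c ` K" using assms(2) by (auto simp: is_translation_of_def)
  have K: "closed K" "convex K" "cone K" "\<And>y. y \<in> polar_cone K \<Longrightarrow> - y \<in> K"
    using assms(1) by (auto simp: obtuse_cone_def)
  have clS: "closed S" "convex S"
    using K closed_translation[of K c] convex_translation[of K c] by (auto simp: S)
  define p where "p = closest_point S x"
  define u where "u = x - p"
  have "p \<in> S" unfolding p_def using clS assms(3) by (intro closest_point_in_set)
  then obtain k where k: "k \<in> K" "p = c + k" by (auto simp: S)
  have le: "u \<bullet> (k' - k) \<le> 0" if "k' \<in> K" for k'
  proof -
    have "c + k' \<in> S" using that by (simp add: S)
    from closest_point_dot[OF clS(2,1) this, of x] show ?thesis
      by (simp add: u_def p_def[symmetric] k(2))
  qed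
  have sc: "t *\<^sub>R k \<in> K" if "t \<ge> 0" for t
    using K(3) k(1) that unfolding cone_def by blast
  \<comment> \<open>The points \<open>0\<close> and \<open>2 k\<close> of the ray through
    \<open>k\<close> give the two opposite inequalities.\<close>
  have "u \<bullet> k = 0"
    using le[OF sc[of 0]] le[OF sc[of 2]] by (simp add: scaleR_2)
  then have "u \<in> polar_cone K"
    using le by (auto simp: polar_cone_def inner_diff_right inner_commute)
  then have "k + - u \<in> K" using K k(1) convex_cone[of K] by blast
  moreover have "relaxed_proj 2 S x = c + (k + - u)"
    by (simp add: relaxed_proj_def p_def[symmetric] u_def k(2) algebra_simps scaleR_2)
  ultimately show ?thesis by (auto simp: S)
qed

section \<open>From contraction over cycles to R-linear rates\<close>

lemma fejer_le:
  fixes x :: "nat \<Rightarrow> 'a::metric_space"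
  assumes "\<And>n. dist (x (Suc n)) c \<le> dist (x n) c" "k \<le> n"
  shows "dist (x n) c \<le> dist (x k) c"
  using assms(2) by (induction n rule: dec_induct) (auto intro: order_trans assms(1))

text \<open>The projection onto \<open>S\<close> of the iterate starting cycle \<open>k\<close> is a
  point of \<open>S\<close>, so by Fejer monotonicity all later iterates stay as close to it as that
  iterate was. The limit inherits this bound, and the triangle inequality through the projection
  produces the factor \<open>2\<close>.\<close>

lemma fejer_geometric_convergence:
  fixes x :: "nat \<Rightarrow> 'a::euclidean_space"
  assumes S: "closed S" "S \<noteq> {}"
    and fejer: "\<And>c n. c \<in> S \<Longrightarrow> dist (x (Suc n)) c \<le> dist (x n) c"
    and q: "0 \<le> q" "q < 1"
    and contr: "\<And>k. infdist (x (a + m * Suc k)) S \<le> q * infdist (x (a + m * k)) S"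
  obtains l where "l \<in> S" "x \<longlonglongrightarrow> l"
    "\<And>k n. a + m * k \<le> n \<Longrightarrow> dist (x n) l \<le> 2 * infdist (x a) S * q ^ k"
proof -
  define D where "D = infdist (x a) S"
  have D0: "D \<ge> 0" by (simp add: D_def infdist_nonneg)
  have geo: "infdist (x (a + m * k)) S \<le> D * q ^ k" for k
  proof (induction k)
    case (Suc k)
    have "infdist (x (a + m * Suc k)) S \<le> q * infdist (x (a + m * k)) S" by (rule contr)
    also have "\<dots> \<le> q * (D * q ^ k)" using Suc q(1) by (rule mult_left_mono)
    finally show ?case by (simp add: mult_ac)
  qed (simp add: D_def)
  have near: "dist (x n) (closest_point S (x (a + m * k))) \<le> D * q ^ k"
    if "a + m * k \<le> n" for n k
  proof -
    have "dist (x n) (closest_point S (x (a + m * k)))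
        \<le> dist (x (a + m * k)) (closest_point S (x (a + m * k)))"
      using closest_point_in_set[OF S] by (intro fejer_le[of x, OF fejer that])
    also have "\<dots> \<le> D * q ^ k"
      using geo[of k] by (simp only: infdist_eq_closest_point[OF S])
    finally show ?thesis .
  qed
  have lim0: "(\<lambda>k. 2 * D * q ^ k) \<longlonglongrightarrow> 0"
    using tendsto_mult_left[OF LIMSEQ_power_zero, of q "2 * D"] q by simp
  have "Cauchy x"
  proof (rule metric_CauchyI)
    fix e :: real assume "e > 0"
    then obtain k where k: "2 * D * q ^ k < e"
      using order_tendstoD(2)[OF lim0] eventually_happens' sequentially_bot by blast
    have "dist (x n) (x n') < e" if "a + m * k \<le> n" "a + m * k \<le> n'" for n n'
      using near[OF that(1)] near[OF that(2)] k
        dist_triangle2[of "x n" "x n'" "closest_point S (x (a + m * k))"] by linarith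
    then show "\<exists>M. \<forall>n\<ge>M. \<forall>n'\<ge>M. dist (x n) (x n') < e" by blast
  qed
  then obtain l where l: "x \<longlonglongrightarrow> l" by (auto simp: Cauchy_convergent_iff convergent_def)
  have lnear: "dist l (closest_point S (x (a + m * k))) \<le> D * q ^ k" for k
    by (rule tendsto_upperbound[OF tendsto_dist[OF l tendsto_const]])
      (auto simp: eventually_sequentially intro!: exI[of _ "a + m * k"] near)
  have "infdist l S \<le> 0"
  proof (rule tendsto_lowerbound)
    show "(\<lambda>k. 2 * D * q ^ k) \<longlonglongrightarrow> 0" by (rule lim0)
    have "infdist l S \<le> 2 * D * q ^ k" for k
    proof -
      have "infdist l S \<le> D * q ^ k"
        using lnear[of k] closest_point_in_set[OF S] by (intro infdist_le2)
      also have "\<dots> \<le> 2 * D * q ^ k" using D0 q(1) by simp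
      finally show ?thesis .
    qed
    then show "\<forall>\<^sub>F k in sequentially. infdist l S \<le> 2 * D * q ^ k" by simp
  qed simp
  then have "infdist l S = 0"
    using infdist_nonneg[of l S] by linarith
  then have "l \<in> S"
    by (simp only: in_closed_iff_infdist_zero[OF S])
  moreover have "dist (x n) l \<le> 2 * infdist (x a) S * q ^ k" if "a + m * k \<le> n" for k n
    using near[OF that] lnear[of k] dist_triangle2[of "x n" l "closest_point S (x (a + m * k))"]
    by (simp add: D_def)
  ultimately show ?thesis using that l by blast
qed

text \<open>Dividing by \<open>r ^ (a + m)\<close> in \<open>\<sigma>\<close> pays for the
  incomplete cycle at the end and for the first \<open>a\<close> terms, where \<open>bd\<close> says
  nothing; the sum of their distances covers those terms. The division is why \<open>r\<close> is
  positive.\<close>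

lemma R_linear_rate_of_cycles:
  fixes x :: "nat \<Rightarrow> 'a::euclidean_space"
  assumes "m \<ge> 1" "0 < r" "r < 1"
    and bd: "\<And>k n. a + m * k \<le> n \<Longrightarrow> dist (x n) l \<le> B * (r ^ m) ^ k"
  shows "R_linear_rate x l r"
proof -
  have B0: "B \<ge> 0" using bd[of 0 a] order_trans[OF zero_le_dist] by simp
  define \<sigma> where "\<sigma> = (B + (\<Sum>n<a. dist (x n) l)) / r ^ (a + m)"
  have \<sigma>0: "\<sigma> \<ge> 0" using B0 assms by (simp add: \<sigma>_def sum_nonneg)
  have \<sigma>eq: "\<sigma> * r ^ (a + m) = B + (\<Sum>n<a. dist (x n) l)" using assms by (simp add: \<sigma>_def)
  have "dist (x n) l \<le> \<sigma> * r ^ n" for n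
  proof (cases "n < a")
    case True
    then have "dist (x n) l \<le> (\<Sum>n<a. dist (x n) l)"
      by (intro member_le_sum) auto
    also have "\<dots> \<le> \<sigma> * r ^ (a + m)" using B0 \<sigma>eq by simp
    also have "\<dots> \<le> \<sigma> * r ^ n"
      using assms True \<sigma>0 by (intro mult_left_mono power_decreasing) auto
    finally show ?thesis .
  next
    case False
    define k where "k = (n - a) div m"
    have k: "a + m * k \<le> n" "n \<le> a + m * k + m"
      using False assms(1) mult_div_mod_eq[of m "n - a"] mod_less_divisor[of m "n - a"]
      unfolding k_def by linarith+
    have "dist (x n) l \<le> B * (r ^ m) ^ k" by (rule bd[OF k(1)])
    also have "\<dots> \<le> \<sigma> * r ^ (a + m) * (r ^ m) ^ k"
      using \<sigma>eq assms by (intro mult_right_mono) (auto simp: sum_nonneg)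
    also have "\<dots> = \<sigma> * r ^ (a + m * k + m)" by (simp add: power_add power_mult[symmetric] mult_ac)
    also have "\<dots> \<le> \<sigma> * r ^ n"
      using assms k(2) \<sigma>0 by (intro mult_left_mono power_decreasing) auto
    finally show ?thesis .
  qed
  then show ?thesis
    unfolding R_linear_rate_def dist_norm using assms \<sigma>0 by auto
qed

text \<open>Cycles of length \<open>1\<close> started at \<open>N\<close> satisfy the bound with
  \<open>B = 0\<close>.\<close>

lemma R_linear_rate_of_eventually_const:
  fixes x :: "nat \<Rightarrow> 'a::euclidean_space"
  assumes "\<And>n. n \<ge> N \<Longrightarrow> x n = l" "0 < r" "r < 1"
  shows "R_linear_rate x l r"
  using assms by (intro R_linear_rate_of_cycles[of 1 r N x l 0]) auto

text \<open>The set \<open>C i\<close> is used at some step \<open>n\<close> of the window, so its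
  distance from \<open>x a\<close> is controlled by step \<open>n\<close> and the path leading
  there. Cauchy-Schwarz compares the total path length with the gains towards \<open>c\<close>,
  which telescope.\<close>

lemma cycle_decrease:
  fixes C :: "'i \<Rightarrow> 'a::euclidean_space set"
  assumes cc: "\<And>i. i \<in> N \<Longrightarrow> closed (C i) \<and> convex (C i)"
    and lam: "\<And>i. i \<in> N \<Longrightarrow> 0 < lam i \<and> lam i < 2"
    and \<nu>: "0 \<le> \<nu>" "\<nu> \<le> 1" "\<And>i. i \<in> N \<Longrightarrow> \<nu> \<le> lam i"
    and "a \<le> b" and bij: "bij_betw s {a..<b} N"
    and step: "\<And>n. n \<in> {a..<b} \<Longrightarrow> x (Suc n) = relaxed_proj (lam (s n)) (C (s n)) (x n)"
    and c: "\<And>i. i \<in> N \<Longrightarrow> c \<in> C i"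
    and i: "i \<in> N"
  shows "\<nu>\<^sup>2 * (infdist (x a) (C i))\<^sup>2
           \<le> (\<Sum>i\<in>N. lam i / (2 - lam i)) * ((dist (x a) c)\<^sup>2 - (dist (x b) c)\<^sup>2)"
proof -
  define g where "g n = norm (x (Suc n) - x n)" for n
  have sN: "s n \<in> N" if "n \<in> {a..<b}" for n using bij_betwE[OF bij] that by blast
  have g: "g n = lam (s n) * infdist (x n) (C (s n))" if "n \<in> {a..<b}" for n
    unfolding g_def step[OF that]
    using cc[OF sN] lam[OF sN] c[OF sN] that
    by (subst relaxed_proj_norm_diff) (auto simp: less_imp_le)
  have dist_a: "dist (x a) (x n) \<le> (\<Sum>j\<in>{a..<n}. g j)" if "a \<le> n" for n
    using that
  proof (induction n rule: dec_induct)
    case (step n)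
    have "dist (x a) (x (Suc n)) \<le> dist (x a) (x n) + g n"
      unfolding g_def by (metis dist_commute dist_norm dist_triangle)
    with step show ?case by simp
  qed simp
  obtain n where n: "n \<in> {a..<b}" "s n = i"
    using bij i unfolding bij_betw_def by blast
  \<comment> \<open>\<open>\<nu> \<le> lam i\<close> turns the distance at \<open>x n\<close> into
    the step length \<open>g n\<close>; \<open>\<nu> \<le> 1\<close> disposes of the factor on the
    path.\<close>
  have "\<nu> * infdist (x a) (C i) \<le> \<nu> * (infdist (x n) (C i) + dist (x a) (x n))"
    using \<nu>(1) by (intro mult_left_mono infdist_triangle)
  also have "\<dots> \<le> g n + (\<Sum>j\<in>{a..<n}. g j)"
  proof -
    have "\<nu> * infdist (x n) (C i) \<le> g n"
      unfolding g[OF n(1)] n(2) using \<nu>(3)[OF i] by (intro mult_right_mono infdist_nonneg)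
    moreover have "\<nu> * dist (x a) (x n) \<le> 1 * (\<Sum>j\<in>{a..<n}. g j)"
      using \<nu> n(1) by (intro mult_mono dist_a) auto
    ultimately show ?thesis by (simp add: distrib_left)
  qed
  also have "\<dots> = (\<Sum>j\<in>{a..<Suc n}. g j)" using n(1) by simp
  also have "\<dots> \<le> (\<Sum>j\<in>{a..<b}. g j)"
    using n(1) by (intro sum_mono2) (auto simp: g_def)
  \<comment> \<open>The weights make the square of the second factor equal to
    \<open>lam * (2 - lam)\<close> times the squared distance, exactly the gain in
    \<open>relaxed_proj_decrease\<close>.\<close>
  also have "\<dots> = (\<Sum>j\<in>{a..<b}. sqrt (lam (s j) / (2 - lam (s j))) *
      (sqrt ((2 - lam (s j)) / lam (s j)) * g j))"
    (is "_ = (\<Sum>j\<in>_. ?u j * (?v j))")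
  proof (rule sum.cong)
    fix j assume "j \<in> {a..<b}"
    then have "0 < lam (s j)" "lam (s j) < 2" using lam[OF sN] by auto
    then show "g j = ?u j * ?v j"
      by (simp add: real_sqrt_mult[symmetric] mult.assoc[symmetric])
  qed simp
  finally have "\<nu> * infdist (x a) (C i) \<le> (\<Sum>j\<in>{a..<b}. ?u j * ?v j)" .
  then have "(\<nu> * infdist (x a) (C i))\<^sup>2 \<le> (\<Sum>j\<in>{a..<b}. ?u j * ?v j)\<^sup>2"
    using \<nu>(1) by (intro power_mono) (auto simp: infdist_nonneg)
  also have "\<dots> \<le> (\<Sum>j\<in>{a..<b}. (?u j)\<^sup>2) * (\<Sum>j\<in>{a..<b}. (?v j)\<^sup>2)"
    by (rule Cauchy_Schwarz_ineq_sum)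
  also have "(\<Sum>j\<in>{a..<b}. (?u j)\<^sup>2) = (\<Sum>j\<in>{a..<b}. lam (s j) / (2 - lam (s j)))"
    using lam[OF sN] by (intro sum.cong) (auto simp: less_imp_le)
  also have "\<dots> = (\<Sum>i\<in>N. lam i / (2 - lam i))"
    by (rule sum.reindex_bij_betw[OF bij])
  also have "(\<Sum>i\<in>N. lam i / (2 - lam i)) * (\<Sum>j\<in>{a..<b}. (?v j)\<^sup>2)
      \<le> (\<Sum>i\<in>N. lam i / (2 - lam i)) * ((dist (x a) c)\<^sup>2 - (dist (x b) c)\<^sup>2)"
  proof (rule mult_left_mono)
    have "(?v j)\<^sup>2 \<le> (dist (x j) c)\<^sup>2 - (dist (x (Suc j)) c)\<^sup>2" if j: "j \<in> {a..<b}" for j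
    proof -
      have l: "0 < lam (s j)" "lam (s j) < 2" using lam[OF sN[OF j]] by auto
      then have "(?v j)\<^sup>2 = (2 - lam (s j)) / lam (s j) * (g j)\<^sup>2"
        by (simp add: power_mult_distrib less_imp_le)
      also have "\<dots> = lam (s j) * (2 - lam (s j)) * (infdist (x j) (C (s j)))\<^sup>2"
        using l by (simp add: g[OF j] power2_eq_square)
      finally show ?thesis
        using relaxed_proj_decrease[of "C (s j)" c "lam (s j)" "x j"] cc[OF sN[OF j]]
          c[OF sN[OF j]] l
        by (simp add: step[OF j] dist_norm)
    qed
    then have "(\<Sum>j\<in>{a..<b}. (?v j)\<^sup>2) \<le> (\<Sum>j\<in>{a..<b}. (dist (x j) c)\<^sup>2 - (dist (x (Suc j)) c)\<^sup>2)"
      by (rule sum_mono)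
    also have "\<dots> = (dist (x a) c)\<^sup>2 - (dist (x b) c)\<^sup>2"
      using sum_Suc_diff'[OF \<open>a \<le> b\<close>, of "\<lambda>j. - (dist (x j) c)\<^sup>2"] by simp
    finally show "(\<Sum>j\<in>{a..<b}. (?v j)\<^sup>2) \<le> (dist (x a) c)\<^sup>2 - (dist (x b) c)\<^sup>2" .
    show "0 \<le> (\<Sum>i\<in>N. lam i / (2 - lam i))"
      using lam by (intro sum_nonneg) (auto simp: less_imp_le)
  qed
  finally show ?thesis by (simp add: power_mult_distrib)
qed

section \<open>Cyclic relaxed projections\<close>

text \<open>Taking for \<open>c\<close> the projection of \<open>x a\<close> onto the intersection
  makes the first distance in \<open>cycle_decrease\<close> the distance to the intersection, while
  \<open>dist (x b) c\<close> still dominates the new one. Linear regularity is applied at the index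
  attaining the maximum.\<close>

lemma cycle_contraction:
  fixes C :: "'i \<Rightarrow> 'a::euclidean_space set"
  assumes I: "finite I" "N \<subseteq> I" "N \<noteq> {}" "(\<Inter>i\<in>I. C i) \<noteq> {}"
    and cc: "\<And>i. i \<in> I \<Longrightarrow> closed (C i) \<and> convex (C i)"
    and lam: "\<And>i. i \<in> N \<Longrightarrow> 0 < lam i \<and> lam i < 2"
    and \<nu>: "0 \<le> \<nu>" "\<nu> \<le> 1" "\<And>i. i \<in> N \<Longrightarrow> \<nu> \<le> lam i"
    and "a \<le> b" and bij: "bij_betw s {a..<b} N"
    and step: "\<And>n. n \<in> {a..<b} \<Longrightarrow> x (Suc n) = relaxed_proj (lam (s n)) (C (s n)) (x n)"
    and rest: "\<And>i. i \<in> I - N \<Longrightarrow> x a \<in> C i"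
    and \<kappa>: "\<kappa> > 0" "infdist (x a) (\<Inter>i\<in>I. C i) \<le> \<kappa> * (MAX i\<in>I. infdist (x a) (C i))"
  shows "(infdist (x b) (\<Inter>i\<in>I. C i))\<^sup>2
    \<le> (1 - \<nu>\<^sup>2 / \<kappa>\<^sup>2 * inverse (\<Sum>i\<in>N. lam i / (2 - lam i))) * (infdist (x a) (\<Inter>i\<in>I. C i))\<^sup>2"
proof -
  define S where "S = (\<Inter>i\<in>I. C i)"
  define \<Lambda> where "\<Lambda> = (\<Sum>i\<in>N. lam i / (2 - lam i))"
  define c where "c = closest_point S (x a)"
  have S: "closed S" "S \<noteq> {}" using cc I by (auto simp: S_def)
  have "finite N" using I(1,2) by (rule finite_subset[rotated])
  then have \<Lambda>: "\<Lambda> > 0" unfolding \<Lambda>_def using I(3) lam by (intro sum_pos) auto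
  have cS: "c \<in> S" unfolding c_def using S by (intro closest_point_in_set)
  then have cC: "c \<in> C i" if "i \<in> I" for i using that by (auto simp: S_def)
  have bound: "\<nu>\<^sup>2 * (infdist (x a) (C i))\<^sup>2 \<le> \<Lambda> * ((dist (x a) c)\<^sup>2 - (dist (x b) c)\<^sup>2)"
    if "i \<in> N" for i
    unfolding \<Lambda>_def
    by (rule cycle_decrease[OF _ lam \<nu> \<open>a \<le> b\<close> bij step _ that]) (use cc cC I(2) in auto)
  have Ine: "I \<noteq> {}" using I by auto
  have "(MAX i\<in>I. infdist (x a) (C i)) \<in> (\<lambda>i. infdist (x a) (C i)) ` I"
    using I(1) Ine by (intro Max_in) auto
  then obtain i where i: "i \<in> I" "(MAX i\<in>I. infdist (x a) (C i)) = infdist (x a) (C i)" by auto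
  \<comment> \<open>If the maximum is attained outside \<open>N\<close>, it is \<open>0\<close>; the
    right-hand side is still nonnegative by the bound for any index in \<open>N\<close>.\<close>
  have key: "\<nu>\<^sup>2 * (infdist (x a) (C i))\<^sup>2 \<le> \<Lambda> * ((dist (x a) c)\<^sup>2 - (dist (x b) c)\<^sup>2)"
  proof (cases "i \<in> N")
    case False
    then have "infdist (x a) (C i) = 0" using rest i by simp
    moreover obtain j where "j \<in> N" using I(3) by blast
    then have "0 \<le> \<Lambda> * ((dist (x a) c)\<^sup>2 - (dist (x b) c)\<^sup>2)"
      using order_trans[OF _ bound[of j]] by simp
    ultimately show ?thesis by simp
  qed (rule bound)
  define d where "d = infdist (x a) S"
  have d: "d = dist (x a) c" unfolding d_def c_def by (rule infdist_eq_closest_point[OF S])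
  have "d \<le> \<kappa> * infdist (x a) (C i)" using \<kappa>(2) i(2) by (simp add: d_def S_def)
  then have "d\<^sup>2 \<le> \<kappa>\<^sup>2 * (infdist (x a) (C i))\<^sup>2"
    using power_mono[of d "\<kappa> * infdist (x a) (C i)" 2] by (simp add: d power_mult_distrib)
  then have "\<nu>\<^sup>2 * d\<^sup>2 \<le> \<nu>\<^sup>2 * (\<kappa>\<^sup>2 * (infdist (x a) (C i))\<^sup>2)" by (intro mult_left_mono) auto
  also have "\<dots> = \<kappa>\<^sup>2 * (\<nu>\<^sup>2 * (infdist (x a) (C i))\<^sup>2)" by simp
  also have "\<dots> \<le> \<kappa>\<^sup>2 * (\<Lambda> * (d\<^sup>2 - (dist (x b) c)\<^sup>2))"
    unfolding d using key by (intro mult_left_mono) auto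
  finally have "(dist (x b) c)\<^sup>2 \<le> (1 - \<nu>\<^sup>2 / \<kappa>\<^sup>2 * inverse \<Lambda>) * d\<^sup>2"
    using \<kappa>(1) \<Lambda> by (simp add: field_simps)
  moreover have "(infdist (x b) S)\<^sup>2 \<le> (dist (x b) c)\<^sup>2"
    using cS by (intro power_mono infdist_le infdist_nonneg)
  ultimately show ?thesis by (simp add: d_def S_def \<Lambda>_def)
qed

text \<open>Two numbers less than \<open>m\<close> apart are not congruent, and counting gives
  surjectivity. The start \<open>a\<close> is arbitrary because windows may begin right after a
  reflection.\<close>

lemma bij_betw_mod_window:
  assumes "m \<ge> 1"
  shows "bij_betw (\<lambda>n. n mod m + 1) {a..<a + m} {1..m::nat}"
proof -
  have lt: False if "n mod m = n' mod m" "n \<in> {a..<a + m}" "n' \<in> {a..<a + m}" "n < n'" for n n'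
  proof -
    have "m dvd n' - n" using that mod_eq_dvd_iff_nat[of n n' m] by simp
    then have "m \<le> n' - n" using that by (intro dvd_imp_le) auto
    with that show False by auto
  qed
  have inj: "inj_on (\<lambda>n. n mod m + 1) {a..<a + m}"
    by (intro inj_onI) (metis lt add_right_cancel linorder_neqE_nat)
  moreover have "(\<lambda>n. n mod m + 1) ` {a..<a + m} = {1..m}"
    using assms inj by (intro card_subset_eq) (auto simp: card_image Suc_le_eq)
  ultimately show ?thesis by (simp add: bij_betw_def)
qed

lemma admissible_modulus_exists:
  fixes C :: "nat \<Rightarrow> 'a::euclidean_space set"
  assumes "m \<ge> 1"
    and cc: "\<And>i. i \<in> {1..m} \<Longrightarrow> closed (C i) \<and> convex (C i)"
    and z: "z \<in> (\<Inter>i\<in>{i \<in> {1..m}. polyhedron (C i)}. C i) \<inter>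
         (\<Inter>i\<in>{1..m} - {i \<in> {1..m}. polyhedron (C i)}. rel_interior (C i))"
  shows "\<exists>\<kappa>. admissible_modulus m C x0 \<kappa>"
proof -
  have zC: "z \<in> (\<Inter>i\<in>{1..m}. C i)"
    using z rel_interior_subset by fastforce
  \<comment> \<open>The summand \<open>1\<close> keeps \<open>\<delta>\<close> positive when
    \<open>x0 = z\<close>.\<close>
  define \<delta> where "\<delta> = 2 * (norm (x0 - z) + 1)"
  have "\<exists>\<kappa>>0. \<forall>x\<in>cball z (\<delta> / 2). \<forall>e\<ge>0. (\<forall>i\<in>{1..m}. infdist x (C i) \<le> e)
           \<longrightarrow> infdist x (\<Inter>i\<in>{1..m}. C i) \<le> \<kappa> * e"
    by (rule bounded_linear_regularity[of _ "{i \<in> {1..m}. polyhedron (C i)}" C z]) (use cc z in auto)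
  then obtain \<kappa> where \<kappa>: "\<kappa> > 0" "\<And>x e. x \<in> cball z (\<delta> / 2) \<Longrightarrow> e \<ge> 0
      \<Longrightarrow> (\<forall>i\<in>{1..m}. infdist x (C i) \<le> e) \<Longrightarrow> infdist x (\<Inter>i\<in>{1..m}. C i) \<le> \<kappa> * e"
    by blast
  have "infdist x (\<Inter>i\<in>{1..m}. C i) \<le> \<kappa> * (MAX i\<in>{1..m}. infdist x (C i))"
    if "x \<in> cball z (\<delta> / 2)" for x
  proof (rule \<kappa>(2)[OF that])
    show le: "\<forall>i\<in>{1..m}. infdist x (C i) \<le> (MAX i\<in>{1..m}. infdist x (C i))" by simp
    show "0 \<le> (MAX i\<in>{1..m}. infdist x (C i))"
      by (rule order_trans[OF infdist_nonneg bspec[OF le, of 1]]) (use assms(1) in auto)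
  qed
  with \<kappa>(1) have "linear_regularity_modulus \<kappa> {1..m} C (cball z (\<delta> / 2))"
    unfolding linear_regularity_modulus_def by blast
  moreover have "infdist x0 (\<Inter>i\<in>{1..m}. C i) \<le> norm (x0 - z)"
    using infdist_le[OF zC, of x0] by (simp add: dist_norm)
  moreover have "\<delta> > 0" unfolding \<delta>_def by (smt (verit) norm_ge_zero)
  ultimately show ?thesis
    unfolding admissible_modulus_def using zC
    by (intro exI[of _ \<kappa>] exI[of _ \<delta>] conjI bexI[of _ z]) (auto simp: \<delta>_def)
qed

text \<open>The contraction factor of the squared distance over one cycle, before the positive part
  and the root are taken.\<close>

definition cyclic_factor :: "nat \<Rightarrow> (nat \<Rightarrow> real) \<Rightarrow> real \<Rightarrow> real" where
  "cyclic_factor m lam \<kappa> =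
     1 - (Min ({1} \<union> lam ` ({1..m} - reflection_indices m lam)))\<^sup>2 / \<kappa>\<^sup>2 *
         inverse (\<Sum>i\<in>{1..m} - reflection_indices m lam. lam i / (2 - lam i))"

lemma cyclic_rate_eq:
  "cyclic_rate m lam \<kappa> = max 0 (cyclic_factor m lam \<kappa>) powr (1 / (2 * real m))"
  by (simp add: cyclic_rate_def cyclic_factor_def Let_def)

lemma cyclic_rate_nonneg: "cyclic_rate m lam \<kappa> \<ge> 0"
  by (simp add: cyclic_rate_eq)

text \<open>Over a full cycle the exponent \<open>1 / (2 * m)\<close> becomes \<open>1 / 2\<close>,
  as needed to pass from squared distances to distances.\<close>

lemma cyclic_rate_power:
  assumes "m \<ge> 1"
  shows "cyclic_rate m lam \<kappa> ^ m = sqrt (max 0 (cyclic_factor m lam \<kappa>))"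
proof (cases "cyclic_factor m lam \<kappa> > 0")
  case True
  define Q where "Q = cyclic_factor m lam \<kappa>"
  have "cyclic_rate m lam \<kappa> ^ m = (Q powr (1 / (2 * real m))) powr real m"
    using True by (subst powr_realpow) (auto simp: cyclic_rate_eq Q_def)
  also have "\<dots> = Q powr (1 / 2)" using assms by (simp add: powr_powr)
  finally show ?thesis using True by (simp add: powr_half_sqrt Q_def)
qed (use assms in \<open>simp add: cyclic_rate_eq\<close>)

lemma cyclic_min_props:
  assumes "\<And>i. i \<in> {1..m} \<Longrightarrow> 0 < lam i \<and> lam i \<le> 2"
  defines "\<nu> \<equiv> Min ({1} \<union> lam ` ({1..m} - reflection_indices m lam))"
  shows "0 < \<nu>" "\<nu> \<le> 1" "\<And>i. i \<in> {1..m} - reflection_indices m lam \<Longrightarrow> \<nu> \<le> lam i"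
proof -
  show "0 < \<nu>" unfolding \<nu>_def using assms(1) by (subst Min_gr_iff) auto
  show "\<nu> \<le> 1" unfolding \<nu>_def by (rule Min_le) auto
  show "\<nu> \<le> lam i" if "i \<in> {1..m} - reflection_indices m lam" for i
    unfolding \<nu>_def using that by (intro Min_le) auto
qed

lemma non_reflection_lt_2:
  assumes "\<And>i. i \<in> {1..m} \<Longrightarrow> 0 < lam i \<and> lam i \<le> 2"
    and "i \<in> {1..m} - reflection_indices m lam"
  shows "0 < lam i \<and> lam i < 2"
  using assms(1)[of i] assms(2) by (auto simp: reflection_indices_def less_le)

text \<open>With no index outside the reflections the sum would be empty, its \<open>inverse\<close>
  would be \<open>0\<close> by convention, and the factor would be \<open>1\<close>.\<close>

lemma cyclic_factor_less_1:
  assumes "\<And>i. i \<in> {1..m} \<Longrightarrow> 0 < lam i \<and> lam i \<le> 2"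
    and "{1..m} - reflection_indices m lam \<noteq> {}" "\<kappa> > 0"
  shows "cyclic_factor m lam \<kappa> < 1"
proof -
  have "(\<Sum>i\<in>{1..m} - reflection_indices m lam. lam i / (2 - lam i)) > 0"
    using assms(2) non_reflection_lt_2[of m lam] assms(1) by (intro sum_pos) auto
  moreover have "Min ({1} \<union> lam ` ({1..m} - reflection_indices m lam)) > 0"
    by (rule cyclic_min_props(1)[OF assms(1)])
  ultimately show ?thesis
    unfolding cyclic_factor_def diff_less_eq less_add_same_cancel1
    using assms(3) by (intro mult_pos_pos divide_pos_pos positive_imp_inverse_positive zero_less_power)
qed

text \<open>A reflection step carries no decrease estimate, but its result lies in the set it reflects
  in.  The cycles are therefore started right after the reflection and stopped just before the
  next one.\<close>

lemma cyclic_convergence: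
  fixes C :: "nat \<Rightarrow> 'a::euclidean_space set" and m :: nat and lam :: "nat \<Rightarrow> real"
  defines "J \<equiv> reflection_indices m lam"
    and "S \<equiv> \<Inter>i\<in>{1..m}. C i"
  assumes m: "m \<ge> 1"
    and cc: "\<And>i. i \<in> {1..m} \<Longrightarrow> closed (C i) \<and> convex (C i)"
    and ne: "S \<noteq> {}"
    and lam: "\<And>i. i \<in> {1..m} \<Longrightarrow> 0 < lam i \<and> lam i \<le> 2"
    and card: "card (J) \<le> 1"
    and obt: "\<And>i. i \<in> J \<Longrightarrow> \<exists>K. obtuse_cone K \<and> is_translation_of (C i) K"
    and m2: "J \<noteq> {} \<Longrightarrow> m \<ge> 2"
    and cyc: "cyclic_sequence m (\<lambda>i. relaxed_proj (lam i) (C i)) x"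
    and adm: "admissible_modulus m C (x 0) \<kappa>"
  obtains a l where "a \<le> m" "J = {} \<Longrightarrow> a = 0" "l \<in> S" "x \<longlonglongrightarrow> l" "cyclic_rate m lam \<kappa> < 1"
    "\<And>k n. a + m * k \<le> n \<Longrightarrow>
       dist (x n) l \<le> 2 * infdist (x a) S * (cyclic_rate m lam \<kappa> ^ m) ^ k"
proof -
  define N where "N = {1..m} - J"
  define s where "s = (\<lambda>n. n mod m + 1)"
  define q where "q = cyclic_rate m lam \<kappa> ^ m"
  have S: "closed S" "S \<noteq> {}" using cc ne by (auto simp: S_def)
  have CS: "C i \<noteq> {}" if "i \<in> {1..m}" for i using ne that by (auto simp: S_def)
  have sI: "s n \<in> {1..m}" for n using m by (auto simp: s_def Suc_le_eq)
  have step: "x (Suc n) = relaxed_proj (lam (s n)) (C (s n)) (x n)" for n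
    using cyc by (simp add: cyclic_sequence_def s_def)
  have fejer: "dist (x (Suc n)) c \<le> dist (x n) c" if "c \<in> S" for c n
    unfolding step using cc[OF sI] lam[OF sI, of n] that sI[of n]
    by (intro relaxed_proj_fejer) (auto simp: S_def)
  obtain \<delta> w where w: "w \<in> S" "\<delta> \<ge> 2 * norm (x 0 - w)"
    "linear_regularity_modulus \<kappa> {1..m} C (cball w (\<delta> / 2))"
    using adm unfolding admissible_modulus_def S_def by blast
  have \<kappa>: "\<kappa> > 0" using w(3) by (simp add: linear_regularity_modulus_def)
  \<comment> \<open>Fejer monotonicity with respect to \<open>w\<close> keeps every iterate in the
    ball where the modulus is valid, so one modulus serves all cycles.\<close>
  have reg: "infdist (x n) S \<le> \<kappa> * (MAX i\<in>{1..m}. infdist (x n) (C i))" for n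
  proof -
    have "dist (x n) w \<le> dist (x 0) w" by (rule fejer_le[of x, OF fejer[OF w(1)]]) simp
    then have "x n \<in> cball w (\<delta> / 2)" using w(2) by (simp add: dist_norm norm_minus_commute[of w])
    then show ?thesis using w(3) by (simp add: linear_regularity_modulus_def S_def)
  qed
  have finJ: "finite (J)" by (simp add: J_def reflection_indices_def)
  have JI: "J \<subseteq> {1..m}" by (auto simp: J_def reflection_indices_def)
  \<comment> \<open>A single reflection exhausts the indices only if \<open>m = 1\<close>, which
    \<open>m2\<close> excludes.\<close>
  have Nne: "N \<noteq> {}"
  proof
    assume "N = {}"
    then have "{1..m} \<subseteq> J" by (auto simp: N_def)
    from card_mono[OF finJ this] card have "m \<le> 1" by simp
    with m m2 JI have "J = {}" by auto
    with \<open>N = {}\<close> m show False by (auto simp: N_def)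
  qed
  have q1: "q < 1"
    unfolding q_def cyclic_rate_power[OF m]
    using cyclic_factor_less_1[of m lam \<kappa>] lam \<kappa> Nne by (simp add: N_def J_def)
  \<comment> \<open>Only the steps in \<open>{a..<b}\<close> have to yield a gain; a step between
    \<open>b\<close> and \<open>a + m\<close> merely must not increase the distance.\<close>
  have contr: "infdist (x (a + m)) S \<le> q * infdist (x a) S"
    if ab: "a \<le> b" "b \<le> a + m" and bij: "bij_betw s {a..<b} N"
      and rest: "\<And>i. i \<in> {1..m} - N \<Longrightarrow> x a \<in> C i" for a b
  proof -
    have "(infdist (x b) S)\<^sup>2 \<le> cyclic_factor m lam \<kappa> * (infdist (x a) S)\<^sup>2"
      unfolding S_def cyclic_factor_def J_def[symmetric] N_def[symmetric]
    proof (rule cycle_contraction[where C = C and lam = lam and s = s and x = x,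
          OF _ _ Nne ne[unfolded S_def] cc _ _ _ _ ab(1) bij step rest \<kappa> reg[unfolded S_def]])
      show "N \<subseteq> {1..m}" by (auto simp: N_def)
      show "0 < lam i \<and> lam i < 2" if "i \<in> N" for i
        using that unfolding N_def J_def by (intro non_reflection_lt_2[of m lam i] lam)
      note \<nu> = cyclic_min_props[of m lam, OF lam, folded J_def, folded N_def]
      show "0 \<le> Min ({1} \<union> lam ` N)" using \<nu>(1) by (rule less_imp_le)
      show "Min ({1} \<union> lam ` N) \<le> 1" by (rule \<nu>(2))
      show "Min ({1} \<union> lam ` N) \<le> lam i" if "i \<in> N" for i using that by (intro \<nu>(3))
    qed auto
    also have "\<dots> \<le> max 0 (cyclic_factor m lam \<kappa>) * (infdist (x a) S)\<^sup>2"
      by (intro mult_right_mono) auto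
    also have "\<dots> = (q * infdist (x a) S)\<^sup>2"
      by (simp add: q_def cyclic_rate_power[OF m] power_mult_distrib)
    finally have "infdist (x b) S \<le> q * infdist (x a) S"
      by (rule power2_le_imp_le) (simp add: q_def cyclic_rate_nonneg infdist_nonneg)
    moreover have "infdist (x (a + m)) S \<le> infdist (x b) S"
    proof -
      have "infdist (x (a + m)) S \<le> dist (x (a + m)) (closest_point S (x b))"
        by (intro infdist_le closest_point_in_set S)
      also have "\<dots> \<le> dist (x b) (closest_point S (x b))"
        using ab by (intro fejer_le[of x, OF fejer] closest_point_in_set S)
      finally show ?thesis by (simp add: infdist_eq_closest_point[OF S])
    qed
    ultimately show ?thesis by linarith
  qed
  have "\<exists>a\<le>m. (J = {} \<longrightarrow> a = 0) \<and>
      (\<forall>k. infdist (x (a + m * Suc k)) S \<le> q * infdist (x (a + m * k)) S)"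
  proof (cases "J = {}")
    case True
    have "infdist (x (m * k + m)) S \<le> q * infdist (x (m * k)) S" for k
      by (rule contr[of "m * k" "m * k + m"])
        (use True bij_betw_mod_window[OF m, of "m * k"] in \<open>auto simp: s_def N_def\<close>)
    then show ?thesis by (intro exI[of _ 0]) (simp add: add.commute)
  next
    case False
    then obtain i where i: "J = {i}"
      using card finJ by (metis One_nat_def card_1_singletonE card_gt_0_iff le_antisym Suc_le_eq)
    then have iI: "i \<in> {1..m}" "lam i = 2" by (auto simp: J_def reflection_indices_def)
    \<comment> \<open>Operator \<open>i\<close> maps iterate \<open>i - 1 + m * k\<close> to iterate
      \<open>i + m * k\<close>, where the window starts.\<close>
    have s_i: "s (i - 1 + m * k) = i" for k
    proof -
      have "(i - 1 + m * k) mod m = i - 1" using iI by (subst mod_mult_self2) auto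
      then show ?thesis using iI by (simp only: s_def) auto
    qed
    have "infdist (x (i + m * k + m)) S \<le> q * infdist (x (i + m * k)) S" for k
    proof (rule contr[of "i + m * k" "i + m * k + m - 1"])
      \<comment> \<open>Of these \<open>m\<close> consecutive steps only the last, numbered
        \<open>i - 1 + m * Suc k\<close>, is the reflection; without it every other index occurs
        once.\<close>
      have "bij_betw s ({i + m * k..<i + m * k + m} - {i - 1 + m * Suc k}) ({1..m} - {i})"
      proof (rule bij_betw_DiffI)
        show "bij_betw s {i + m * k..<i + m * k + m} {1..m}"
          unfolding s_def by (rule bij_betw_mod_window[OF m])
        show "bij_betw s {i - 1 + m * Suc k} {i}"
          unfolding bij_betw_def using s_i[of "Suc k"] by (simp del: mult_Suc_right)
      qed (use iI in auto)
      moreover have "{i + m * k..<i + m * k + m} - {i - 1 + m * Suc k}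
          = {i + m * k..<i + m * k + m - 1}"
        using iI by auto
      ultimately show "bij_betw s {i + m * k..<i + m * k + m - 1} N"
        by (simp add: N_def i)
      fix j assume "j \<in> {1..m} - N"
      then have "j = i" using i by (auto simp: N_def)
      obtain K where "obtuse_cone K" "is_translation_of (C i) K" using obt i by auto
      then have "relaxed_proj 2 (C i) (x (i - 1 + m * k)) \<in> C i"
        using CS iI by (intro reflection_mem_obtuse)
      moreover have "Suc (i - 1 + m * k) = i + m * k" using iI by simp
      ultimately show "x (i + m * k) \<in> C j"
        using step[of "i - 1 + m * k"] s_i[of k] iI(2) \<open>j = i\<close> by simp
    qed (use m in auto)
    then show ?thesis
      using iI False by (intro exI[of _ i]) (simp add: ac_simps)
  qed
  then obtain a where a: "a \<le> m" "J = {} \<Longrightarrow> a = 0"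
    "\<And>k. infdist (x (a + m * Suc k)) S \<le> q * infdist (x (a + m * k)) S" by blast
  have q0: "0 \<le> q" by (simp add: q_def cyclic_rate_nonneg)
  obtain l where l: "l \<in> S" "x \<longlonglongrightarrow> l"
    "\<And>k n. a + m * k \<le> n \<Longrightarrow> dist (x n) l \<le> 2 * infdist (x a) S * q ^ k"
    using fejer_geometric_convergence[OF S fejer q0 q1 a(3)] by blast
  have "cyclic_rate m lam \<kappa> < 1"
    using q1 one_le_power[of "cyclic_rate m lam \<kappa>" m] unfolding q_def by linarith
  with that a(1,2) l show ?thesis unfolding q_def by blast
qed

section \<open>Finite convergence and the rate zero\<close>

lemma relaxed_proj_self:
  "x \<in> S \<Longrightarrow> relaxed_proj l S x = x"
  by (simp add: relaxed_proj_def closest_point_self algebra_simps)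

lemma cyclic_sequence_const:
  fixes C :: "nat \<Rightarrow> 'a::euclidean_space set"
  assumes "m \<ge> 1" "cyclic_sequence m (\<lambda>i. relaxed_proj (lam i) (C i)) x"
    and "x k \<in> (\<Inter>i\<in>{1..m}. C i)" "k \<le> n"
  shows "x n = x k"
  using assms(4)
proof (induction n rule: dec_induct)
  case (step n)
  have "n mod m + 1 \<in> {1..m}" using assms(1) by (auto simp: Suc_le_eq)
  then have "x n \<in> C (n mod m + 1)" using step assms(3) by auto
  then show ?case using assms(2) step by (simp add: cyclic_sequence_def relaxed_proj_self)
qed simp

text \<open>A point of the ball outside the intersection forces \<open>\<kappa> \<ge> 1\<close>, and \<open>\<lambda> (2 - \<lambda>) \<le> 1\<close> bounds every
  summand of the rate below by \<open>\<nu>\<^sup>2\<close>; so \<open>m \<nu>\<^sup>2 \<le> \<nu>\<^sup>2\<close>.\<close>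

lemma cyclic_rate_zero:
  fixes C :: "nat \<Rightarrow> 'a::euclidean_space set"
  assumes m: "m \<ge> 1"
    and lam: "\<And>i. i \<in> {1..m} \<Longrightarrow> 0 < lam i \<and> lam i \<le> 2"
    and J: "reflection_indices m lam = {}"
    and adm: "admissible_modulus m C x0 \<kappa>"
    and r: "cyclic_rate m lam \<kappa> = 0"
    and S: "closed (\<Inter>i\<in>{1..m}. C i)" "x0 \<notin> (\<Inter>i\<in>{1..m}. C i)"
  shows "m = 1"
proof -
  define S where "S = (\<Inter>i\<in>{1..m}. C i)"
  define \<nu> where "\<nu> = Min ({1} \<union> lam ` ({1..m} - reflection_indices m lam))"
  define \<Lambda> where "\<Lambda> = (\<Sum>i\<in>{1..m}. lam i / (2 - lam i))"
  obtain \<delta> w where w: "w \<in> S" "\<delta> \<ge> 2 * norm (x0 - w)"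
    "linear_regularity_modulus \<kappa> {1..m} C (cball w (\<delta> / 2))"
    using adm unfolding admissible_modulus_def S_def by blast
  have \<kappa>: "\<kappa> > 0" using w(3) by (simp add: linear_regularity_modulus_def)
  have "x0 \<in> cball w (\<delta> / 2)" using w(2) by (simp add: dist_norm norm_minus_commute[of w])
  then have "infdist x0 S \<le> \<kappa> * (MAX i\<in>{1..m}. infdist x0 (C i))"
    using w(3) by (simp add: linear_regularity_modulus_def S_def)
  also have "\<dots> \<le> \<kappa> * infdist x0 S"
  proof (rule mult_left_mono)
    have "infdist x0 (C i) \<le> infdist x0 S" if "i \<in> {1..m}" for i
      using that w(1) by (intro infdist_mono) (auto simp: S_def)
    then show "(MAX i\<in>{1..m}. infdist x0 (C i)) \<le> infdist x0 S"
      using m by (subst Max_le_iff) auto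
  qed (use \<kappa> in simp)
  finally have "infdist x0 S \<le> \<kappa> * infdist x0 S" .
  moreover have "infdist x0 S > 0"
    using S w(1) by (intro infdist_pos_not_in_closed) (auto simp: S_def)
  ultimately have \<kappa>1: "\<kappa> \<ge> 1" by simp
  have \<nu>: "0 < \<nu>" "\<nu> \<le> 1" "\<And>i. i \<in> {1..m} \<Longrightarrow> \<nu> \<le> lam i"
    unfolding \<nu>_def using cyclic_min_props[of m lam] lam J by auto
  have lt2: "0 < lam i \<and> lam i < 2" if "i \<in> {1..m}" for i
    using non_reflection_lt_2[of m lam i] lam J that by auto
  have summand: "\<nu>\<^sup>2 \<le> lam i / (2 - lam i)" if "i \<in> {1..m}" for i
  proof -
    have l: "0 < lam i" "lam i < 2" using lt2[OF that] by auto
    have "lam i * (2 - lam i) \<le> 1"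
      using zero_le_power2[of "lam i - 1"] by (simp add: power2_eq_square algebra_simps)
    then have "lam i * (lam i * (2 - lam i)) \<le> lam i * 1"
      using l by (intro mult_left_mono) auto
    then have "(lam i)\<^sup>2 \<le> lam i / (2 - lam i)"
      using l by (simp add: power2_eq_square field_simps)
    moreover have "\<nu>\<^sup>2 \<le> (lam i)\<^sup>2" using \<nu>(1) \<nu>(3)[OF that] by (intro power_mono) auto
    ultimately show ?thesis by linarith
  qed
  have "real m * \<nu>\<^sup>2 = (\<Sum>i\<in>{1..m}. \<nu>\<^sup>2)" by simp
  also have "\<dots> \<le> \<Lambda>" unfolding \<Lambda>_def by (intro sum_mono summand)
  finally have m\<Lambda>: "real m * \<nu>\<^sup>2 \<le> \<Lambda>" .
  moreover have "real m * \<nu>\<^sup>2 > 0" using m \<nu>(1) by simp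
  ultimately have \<Lambda>: "\<Lambda> > 0" by linarith
  have "cyclic_factor m lam \<kappa> \<le> 0"
    using r by (auto simp: cyclic_rate_eq max_def split: if_splits)
  moreover have "cyclic_factor m lam \<kappa> = 1 - \<nu>\<^sup>2 / \<kappa>\<^sup>2 * inverse \<Lambda>"
    by (simp add: cyclic_factor_def \<nu>_def \<Lambda>_def J)
  ultimately have "\<kappa>\<^sup>2 * \<Lambda> \<le> \<nu>\<^sup>2"
    using \<kappa> \<Lambda> by (simp add: field_simps)
  moreover have "1 * \<Lambda> \<le> \<kappa>\<^sup>2 * \<Lambda>"
    using \<Lambda> \<kappa>1 by (intro mult_right_mono) (auto simp: one_le_power)
  ultimately have "real m * \<nu>\<^sup>2 \<le> 1 * \<nu>\<^sup>2" using m\<Lambda> by linarith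
  then have "real m \<le> 1" using \<nu>(1) by (subst (asm) mult_le_cancel_right) auto
  with m show ?thesis by simp
qed

text \<open>\<open>l\<close> is chosen before \<open>\<kappa>\<close>, so one limit serves all
  moduli, and the last conjunct makes the claim about rates nonvacuous. With a reflection present, a
  zero rate only yields finite termination, since the estimates begin with the first window.\<close>

theorem corollary5p12:
  fixes C :: "nat \<Rightarrow> 'a::euclidean_space set"
    and m :: nat
    and lam :: "nat \<Rightarrow> real"
  assumes "m \<ge> 1"
    and "\<And>i. i \<in> {1..m} \<Longrightarrow> closed (C i) \<and> convex (C i)"
    and "(\<Inter>i\<in>{i \<in> {1..m}. polyhedron (C i)}. C i) \<inter>
         (\<Inter>i\<in>{1..m} - {i \<in> {1..m}. polyhedron (C i)}. rel_interior (C i)) \<noteq> {}"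
    and "\<And>i. i \<in> {1..m} \<Longrightarrow> 0 < lam i \<and> lam i \<le> 2"
    and "card (reflection_indices m lam) \<le> 1"
    and "\<And>i. i \<in> reflection_indices m lam \<Longrightarrow> \<exists>K. obtuse_cone K \<and> is_translation_of (C i) K"
  shows "(\<forall>x. cyclic_sequence m (\<lambda>i. relaxed_proj (lam i) (C i)) x \<longrightarrow>
            (\<exists>l\<in>(\<Inter>i\<in>{1..m}. C i).
               R_linear_convergent_to x l \<and>
               ((reflection_indices m lam \<noteq> {} \<longrightarrow> m \<ge> 2) \<longrightarrow>
                  (\<forall>\<kappa>. admissible_modulus m C (x 0) \<kappa> \<longrightarrow>
                     (cyclic_rate m lam \<kappa> > 0 \<or> reflection_indices m lam = {} \<longrightarrow>
                        R_linear_rate x l (cyclic_rate m lam \<kappa>)) \<and>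
                     (cyclic_rate m lam \<kappa> = 0 \<longrightarrow> (\<forall>n\<ge>2 * m. x n = l)))))) \<and>
         (\<forall>x0. \<exists>\<kappa>. admissible_modulus m C x0 \<kappa>)"
proof (rule conjI)
  note m = assms(1) and cc = assms(2) and lam = assms(4) and obt = assms(6)
  define S where "S = (\<Inter>i\<in>{1..m}. C i)"
  define J where "J = reflection_indices m lam"
  obtain z where z: "z \<in> (\<Inter>i\<in>{i \<in> {1..m}. polyhedron (C i)}. C i) \<inter>
         (\<Inter>i\<in>{1..m} - {i \<in> {1..m}. polyhedron (C i)}. rel_interior (C i))"
    using assms(3) by blast
  have "z \<in> S" using z rel_interior_subset unfolding S_def by fastforce
  then have S: "S \<noteq> {}" "closed S" using cc by (auto simp: S_def)
  have ex: "\<exists>\<kappa>. admissible_modulus m C x0 \<kappa>" for x0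
    by (rule admissible_modulus_exists[OF m cc z])
  then show "\<forall>x0. \<exists>\<kappa>. admissible_modulus m C x0 \<kappa>" by blast
  have "\<exists>l\<in>S. R_linear_convergent_to x l \<and> ((J \<noteq> {} \<longrightarrow> m \<ge> 2) \<longrightarrow>
          (\<forall>\<kappa>. admissible_modulus m C (x 0) \<kappa> \<longrightarrow>
             (cyclic_rate m lam \<kappa> > 0 \<or> J = {} \<longrightarrow> R_linear_rate x l (cyclic_rate m lam \<kappa>)) \<and>
             (cyclic_rate m lam \<kappa> = 0 \<longrightarrow> (\<forall>n\<ge>2 * m. x n = l))))"
    if cyc: "cyclic_sequence m (\<lambda>i. relaxed_proj (lam i) (C i)) x" for x
  proof (cases "J \<noteq> {} \<longrightarrow> m \<ge> 2")
    case False
    \<comment> \<open>The only operator is a reflection, so there is no step with a gain; but one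
      step lands in \<open>C 1 = S\<close>, where the sequence stays.\<close>
    then have "m = 1" using m by auto
    with False have m1: "m = 1" "J = {1}"
      by (auto simp: J_def reflection_indices_def)
    then have "lam 1 = 2" by (auto simp: J_def reflection_indices_def)
    then have "x 1 = relaxed_proj 2 (C 1) (x 0)"
      using cyc m1(1) by (simp add: cyclic_sequence_def)
    moreover obtain K where "obtuse_cone K" "is_translation_of (C 1) K"
      using obt[of 1] m1 by (auto simp: J_def)
    ultimately have x1: "x 1 \<in> S"
      using reflection_mem_obtuse[of K "C 1" "x 0"] S m1(1) by (simp add: S_def)
    then have "x n = x 1" if "n \<ge> 1" for n
      using that by (intro cyclic_sequence_const[OF m cyc]) (simp_all add: S_def)
    then have "R_linear_rate x (x 1) (1 / 2)"
      by (rule R_linear_rate_of_eventually_const) auto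
    with False x1 show ?thesis unfolding R_linear_convergent_to_def by blast
  next
    case True
    \<comment> \<open>Any modulus may be used to fix the limit; by uniqueness of limits every other
      one leads to the same point.\<close>
    obtain \<kappa>0 where \<kappa>0: "admissible_modulus m C (x 0) \<kappa>0" using ex by blast
    obtain l where l: "l \<in> S" "x \<longlonglongrightarrow> l"
      by (rule cyclic_convergence[where C = C, OF m cc S(1)[unfolded S_def] lam assms(5) obt
            True[unfolded J_def, rule_format] cyc \<kappa>0]) (auto simp: S_def)
    have rate: "(cyclic_rate m lam \<kappa> > 0 \<or> J = {} \<longrightarrow> R_linear_rate x l (cyclic_rate m lam \<kappa>)) \<and>
             (cyclic_rate m lam \<kappa> = 0 \<longrightarrow> (\<forall>n\<ge>2 * m. x n = l))"
      if adm: "admissible_modulus m C (x 0) \<kappa>" for \<kappa>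
    proof -
      define r where "r = cyclic_rate m lam \<kappa>"
      have r0: "r \<ge> 0" by (simp add: r_def cyclic_rate_nonneg)
      obtain a l' where a: "a \<le> m" "J = {} \<Longrightarrow> a = 0" "x \<longlonglongrightarrow> l'" "r < 1"
        "\<And>k n. a + m * k \<le> n \<Longrightarrow> dist (x n) l' \<le> 2 * infdist (x a) S * (r ^ m) ^ k"
        by (rule cyclic_convergence[where C = C, OF m cc S(1)[unfolded S_def] lam assms(5) obt
            True[unfolded J_def, rule_format] cyc adm]) (auto simp: S_def J_def r_def)
      have "l' = l" using LIMSEQ_unique a(3) l(2) by blast
      \<comment> \<open>One cycle after \<open>a\<close> the bound contains
        \<open>0 ^ m = 0\<close>; together with \<open>a \<le> m\<close> this explains the threshold
        \<open>2 * m\<close>.\<close>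
      have const: "x n = l" if "r = 0" "a + m \<le> n" for n
        using a(5)[of 1 n] that m \<open>l' = l\<close> by (simp add: power_0_left)
      have "R_linear_rate x l r" if "r > 0"
        using a(5) \<open>l' = l\<close> by (intro R_linear_rate_of_cycles[OF m that a(4)]) auto
      \<comment> \<open>Rate \<open>0\<close> demands \<open>x n = l\<close> from
        \<open>n = 1\<close> on, while \<open>const\<close> with \<open>a = 0\<close> gives it only
        from \<open>n = m\<close> on. A start in \<open>S\<close> makes the sequence constant, and a
        start outside \<open>S\<close> forces \<open>m = 1\<close>.\<close>
      moreover have "R_linear_rate x l 0" if r: "r = 0" "J = {}"
      proof -
        have "x n = l" if "n \<ge> 1" for n
        proof (cases "x 0 \<in> S")
          case True
          then have "x n = x 0" "x (a + m) = x 0"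
            unfolding S_def by (intro cyclic_sequence_const[OF m cyc]; simp)+
          then show ?thesis using const[OF r(1), of "a + m"] by simp
        next
          case False
          have "m = 1"
            by (rule cyclic_rate_zero[OF m lam r(2)[unfolded J_def] adm r(1)[unfolded r_def]])
              (use S False in \<open>auto simp: S_def\<close>)
          then show ?thesis using const[OF r(1), of n] a(2)[OF r(2)] that by simp
        qed
        \<comment> \<open>At \<open>n = 0\<close> the factor \<open>0 ^ 0 = 1\<close> leaves a
          trivial bound.\<close>
        then have "norm (x n - l) \<le> norm (x 0 - l) * 0 ^ n" for n by (cases n) auto
        then show ?thesis unfolding R_linear_rate_def by (auto intro!: exI[of _ "norm (x 0 - l)"])
      qed
      moreover have "x n = l" if "r = 0" "n \<ge> 2 * m" for n
        using const[OF that(1)] that(2) a(1) by simp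
      ultimately show ?thesis using r0 by (fold r_def) (metis order_le_less)
    qed
    have "R_linear_convergent_to x l"
    proof (cases "cyclic_rate m lam \<kappa>0 = 0")
      case True
      then have "R_linear_rate x l (1 / 2)"
        using rate[OF \<kappa>0] by (intro R_linear_rate_of_eventually_const[of "2 * m"]) auto
      then show ?thesis unfolding R_linear_convergent_to_def by blast
    next
      case False
      then have "cyclic_rate m lam \<kappa>0 > 0" by (simp add: less_le cyclic_rate_nonneg)
      then show ?thesis using rate[OF \<kappa>0] unfolding R_linear_convergent_to_def by blast
    qed
    with l(1) rate show ?thesis by blast
  qed
  then show "\<forall>x. cyclic_sequence m (\<lambda>i. relaxed_proj (lam i) (C i)) x \<longrightarrow>
            (\<exists>l\<in>(\<Inter>i\<in>{1..m}. C i).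
               R_linear_convergent_to x l \<and>
               ((reflection_indices m lam \<noteq> {} \<longrightarrow> m \<ge> 2) \<longrightarrow>
                  (\<forall>\<kappa>. admissible_modulus m C (x 0) \<kappa> \<longrightarrow>
                     (cyclic_rate m lam \<kappa> > 0 \<or> reflection_indices m lam = {} \<longrightarrow>
                        R_linear_rate x l (cyclic_rate m lam \<kappa>)) \<and>
                     (cyclic_rate m lam \<kappa> = 0 \<longrightarrow> (\<forall>n\<ge>2 * m. x n = l)))))"
    unfolding S_def J_def by blast
qed

end
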